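(* Let $A_d\in\mathbb{R}^{n\times n}$, $B_d\in\mathbb{R}^{n\times m}$, let $\pi:\mathbb{R}^n\to\mathbb{R}^m$ be an $\ell$-layer ReLU feedforward neural network, and let $\mathbf{f}_{cl}(x)=A_dx+B_d\pi(x)$. Let $\mathcal{Z}=CZ\{\mathbf{c},\mathbf{G},\mathbf{A},\mathbf{b}\}\subset\mathbb{R}^n$ be any constrained zonotope, with $\mathbf{G}\in\mathbb{R}^{n\times n_G}$ and $\mathbf{A}\in\mathbb{R}^{n_A\times n_G}$, and let $\pi(\mathcal{Z})=\bigcup_{i=1}^{n_\pi}CZ\{\mathbf{c}_i,\mathbf{G}_i,\mathbf{A}_i,\mathbf{b}_i\}$ be the output set computed by the exact output analysis algorithm (described in the context) from the input $\mathcal{Z}$. Let $n_{G_i}$ be the number of columns of $\mathbf{G}_i$. Then $$\mathbf{f}_{cl}(\mathcal{Z})=\bigcup_{i=1}^{n_\pi}CZ\{\mathbf{c}_i^{cl},\mathbf{G}_i^{cl},\mathbf{A}_i^{cl},\mathbf{b}_i^{cl}\},$$ where $$\mathbf{G}_i^{cl}=A_d\begin{bmatrix}\mathbf{G}&\mathbf{0}_{n\times(n_{G_i}-n_G)}\end{bmatrix}+B_d\mathbf{G}_i,\quad \mathbf{c}_i^{cl}=A_d\mathbf{c}+B_d\mathbf{c}_i,\quad \mathbf{A}_i^{cl}=\mathbf{A}_i,\quad \mathbf{b}_i^{cl}=\mathbf{b}_i .$$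
   Context: Constrained zonotopes. For $\mathbf{c}\in\mathbb{R}^n$, $\mathbf{G}\in\mathbb{R}^{n\times n_G}$, $\mathbf{A}\in\mathbb{R}^{n_A\times n_G}$, $\mathbf{b}\in\mathbb{R}^{n_A}$, write $CZ\{\mathbf{c},\mathbf{G},\mathbf{A},\mathbf{b}\}=\{\mathbf{G}\xi+\mathbf{c} : \|\xi\|_\infty\le 1,\ \mathbf{A}\xi=\mathbf{b}\}$. For a set $\mathcal{Z}$, $\mathbf{f}_{cl}(\mathcal{Z})=\{\mathbf{f}_{cl}(x):x\in\mathcal{Z}\}$. Network. Given weight matrices $\mathbf{W}^{(0)},\dots,\mathbf{W}^{(\ell-1)}$ and bias vectors $\mathbf{v}^{(0)},\dots,\mathbf{v}^{(\ell-1)}$ of compatible sizes, $\pi$ is defined by $x^{(0)}=x$, $x^{(k)}=\max\{0,\mathbf{W}^{(k-1)}x^{(k-1)}+\mathbf{v}^{(k-1)}\}$ (componentwise) for $k=1,\dots,\ell-1$, and $\pi(x)=\mathbf{W}^{(\ell-1)}x^{(\ell-1)}+\mathbf{v}^{(\ell-1)}$. Exact output analysis algorithm. It operates on finite lists of constrained zonotopes (a list represents the union of its members), each stored with its data $(\mathbf{c},\mathbf{G},\mathbf{A},\mathbf{b})$, starting from the one-element list $\mathcal{Z}$. For each layer $k=1,\dots,\ell-1$, with $\mathbf{W}=\mathbf{W}^{(k-1)}$, $\mathbf{v}=\mathbf{v}^{(k-1)}$, each member $\mathcal{Z}_h=CZ\{\mathbf{c},\mathbf{G},\mathbf{A},\mathbf{b}\}$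 of the current list is processed as follows, and the new list consists of all resulting pieces: (1) Set $\mathcal{I}=CZ\{\mathbf{W}\mathbf{c}+\mathbf{v},\mathbf{W}\mathbf{G},\mathbf{A},\mathbf{b}\}$, and let $lb_i,up_i$ be the minimum and maximum of the $i$-th coordinate over $\mathcal{I}$. (2) Successively for each coordinate $i$ with $lb_i<0$, replace every piece $\mathcal{I}_j$ in the current list obtained from $\mathcal{I}$ as follows. Let $\mathbf{E}_i$ be the identity matrix with its $i$-th column replaced by $0$. If $up_i\le 0$, replace $\mathcal{I}_j$ by $\mathbf{E}_i\mathcal{I}_j$. If $up_i>0$, replace $\mathcal{I}_j$ by the two pieces $\mathcal{I}_j\cap\{x:x_i\ge0\}$ and $\mathbf{E}_i(\mathcal{I}_j\cap\{x:x_i\le0\})$. In the last layer, each member $CZ\{\mathbf{c},\mathbf{G},\mathbf{A},\mathbf{b}\}$ is replaced by $CZ\{\mathbf{W}^{(\ell-1)}\mathbf{c}+\mathbf{v}^{(\ell-1)},\mathbf{W}^{(\ell-1)}\mathbf{G},\mathbf{A},\mathbf{b}\}$. Representations used: $\mathbf{E}_i\,CZ\{\mathbf{c},\mathbf{G},\mathbf{A},\mathbf{b}\}=CZ\{\mathbf{E}_i\mathbf{c},\mathbf{E}_i\mathbf{G},\mathbf{A},\mathbf{b}\}$; and the intersection of $CZ\{\mathbf{c},\mathbf{G},\mathbf{A},\mathbf{b}\}$ with a halfspace $\{x:\mathbf{h}^Tx\le f\}$ is represented as $$CZ\left\{\mathbf{c},\begin{bmatrix}\mathbf{G}&\mathbf{0}\end{bmatrix},\begin{bmatrix}\mathbf{A}&\mathbf{0}\\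 \mathbf{h}^T\mathbf{G}&\frac{d_m}{2}\end{bmatrix},\begin{bmatrix}\mathbf{b}\\ f-\mathbf{h}^T\mathbf{c}-\frac{d_m}{2}\end{bmatrix}\right\},\quad d_m=f-\mathbf{h}^T\mathbf{c}+\sum_{r}|\mathbf{h}^T\mathbf{G}[:,r]|,$$ where $\mathbf{G}[:,r]$ is the $r$-th column (one zero column is appended to $\mathbf{G}$), used with $f=0$ and $\mathbf{h}=\mathbf{e}_i$ or $\mathbf{h}=-\mathbf{e}_i$. Empty pieces are discarded. *)

theory Defs
  imports "Jordan_Normal_Form.Matrix"
begin

section \<open>Constrained zonotopes\<close>

text \<open>The condition on the infinity norm of \<open>\<xi>\<close> is written componentwise, which also covers
  the case of no generators.\<close>

definition CZ :: "real vec \<Rightarrow> real mat \<Rightarrow> real mat \<Rightarrow> real vec \<Rightarrow> real vec set" where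
  "CZ c G A b = {G *\<^sub>v \<xi> + c | \<xi>.
     \<xi> \<in> carrier_vec (dim_col G) \<and> (\<forall>r < dim_col G. \<bar>\<xi> $ r\<bar> \<le> 1) \<and> A *\<^sub>v \<xi> = b}"

text \<open>The algorithm manipulates the data \<open>(c, G, A, b)\<close>, not the sets they denote.\<close>

type_synonym cz_data = "real vec \<times> real mat \<times> real mat \<times> real vec"

fun cz_set :: "cz_data \<Rightarrow> real vec set" where
  "cz_set (c, G, A, b) = CZ c G A b"

definition append_zero_cols :: "real mat \<Rightarrow> nat \<Rightarrow> real mat" where
  "append_zero_cols G k =
     four_block_mat G (0\<^sub>m (dim_row G) k) (0\<^sub>m 0 (dim_col G)) (0\<^sub>m 0 k)"

fun cz_affine :: "real mat \<Rightarrow> real vec \<Rightarrow> cz_data \<Rightarrow> cz_data" where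
  "cz_affine W v (c, G, A, b) = (W *\<^sub>v c + v, W * G, A, b)"

fun cz_linear :: "real mat \<Rightarrow> cz_data \<Rightarrow> cz_data" where
  "cz_linear M (c, G, A, b) = (M *\<^sub>v c, M * G, A, b)"

text \<open>Intersection with the halfspace of all \<open>x\<close> such that \<open>h \<bullet> x \<le> f\<close>. This is a formula on
  the data: it represents the intersection whenever \<open>d\<^sub>m \<ge> 0\<close>, but may fail to otherwise.\<close>

fun cz_halfspace :: "real vec \<Rightarrow> real \<Rightarrow> cz_data \<Rightarrow> cz_data" where
  "cz_halfspace h f (c, G, A, b) =
     (let d\<^sub>m = f - h \<bullet> c + (\<Sum>r<dim_col G. \<bar>h \<bullet> col G r\<bar>) in
       (c,
        append_zero_cols G 1,
        four_block_mat A (0\<^sub>m (dim_row A) 1)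
                       (mat_of_row h * G) (mat 1 1 (\<lambda>_. d\<^sub>m / 2)),
        b @\<^sub>v vec 1 (\<lambda>_. f - h \<bullet> c - d\<^sub>m / 2)))"

section \<open>ReLU networks\<close>

text \<open>A network with \<open>L \<ge> 1\<close> layers is given by \<open>W k\<close> and \<open>v k\<close> for \<open>k < L\<close>.\<close>

definition relu :: "real vec \<Rightarrow> real vec" where
  "relu = map_vec (max 0)"

fun hidden_state :: "(nat \<Rightarrow> real mat) \<Rightarrow> (nat \<Rightarrow> real vec) \<Rightarrow> real vec \<Rightarrow> nat \<Rightarrow> real vec" where
  "hidden_state W v x 0 = x"
| "hidden_state W v x (Suc k) = relu (W k *\<^sub>v hidden_state W v x k + v k)"

definition network ::
    "nat \<Rightarrow> (nat \<Rightarrow> real mat) \<Rightarrow> (nat \<Rightarrow> real vec) \<Rightarrow> real vec \<Rightarrow> real vec" where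
  "network L W v x = W (L - 1) *\<^sub>v hidden_state W v x (L - 1) + v (L - 1)"

section \<open>Exact output analysis\<close>

text \<open>The minimum and maximum of a coordinate exist whenever the constrained zonotope is nonempty,
  since it is compact. On an empty one they are unspecified, which is harmless: every piece
  derived from it is empty as well.\<close>

definition coord_min :: "real vec set \<Rightarrow> nat \<Rightarrow> real" where
  "coord_min S i = (LEAST t. t \<in> (\<lambda>x. x $ i) ` S)"

definition coord_max :: "real vec set \<Rightarrow> nat \<Rightarrow> real" where
  "coord_max S i = (GREATEST t. t \<in> (\<lambda>x. x $ i) ` S)"

definition proj_mat :: "nat \<Rightarrow> nat \<Rightarrow> real mat" where
  "proj_mat n i = mat n n (\<lambda>(r, s). if s = i then 0 else 1\<^sub>m n $$ (r, s))"

definition relu_coord :: "nat \<Rightarrow> real vec set \<Rightarrow> nat \<Rightarrow> cz_data list \<Rightarrow> cz_data list" where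
  "relu_coord n I i Js =
     filter (\<lambda>J. cz_set J \<noteq> {})
      (if coord_min I i < 0 then
         if coord_max I i \<le> 0 then map (cz_linear (proj_mat n i)) Js
         else concat (map (\<lambda>J.
                [cz_halfspace (- unit_vec n i) 0 J,
                 cz_linear (proj_mat n i) (cz_halfspace (unit_vec n i) 0 J)]) Js)
       else Js)"

text \<open>All coordinate bounds are taken over the affine image \<open>I\<close>, not over the current pieces.\<close>

definition relu_layer :: "real mat \<Rightarrow> real vec \<Rightarrow> cz_data \<Rightarrow> cz_data list" where
  "relu_layer W v Z =
     (let I = cz_affine W v Z; n = dim_row W
      in fold (relu_coord n (cz_set I)) [0..<n] [I])"

fun hidden_pieces ::
    "(nat \<Rightarrow> real mat) \<Rightarrow> (nat \<Rightarrow> real vec) \<Rightarrow> cz_data \<Rightarrow> nat \<Rightarrow> cz_data list" where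
  "hidden_pieces W v Z 0 = [Z]"
| "hidden_pieces W v Z (Suc k) = concat (map (relu_layer (W k) (v k)) (hidden_pieces W v Z k))"

definition exact_output ::
    "nat \<Rightarrow> (nat \<Rightarrow> real mat) \<Rightarrow> (nat \<Rightarrow> real vec) \<Rightarrow> cz_data \<Rightarrow> cz_data list" where
  "exact_output L W v Z = map (cz_affine (W (L - 1)) (v (L - 1))) (hidden_pieces W v Z (L - 1))"

text \<open>Generators are only ever appended, so the natural-number difference between the numbers of
  generators of an output piece and of the input never truncates.\<close>

fun num_gens :: "cz_data \<Rightarrow> nat" where
  "num_gens (c, G, A, b) = dim_col G"

lemma num_gens_affine [simp]: "num_gens (cz_affine W v Z) = num_gens Z"
  by (cases Z) simp

lemma num_gens_linear [simp]: "num_gens (cz_linear M Z) = num_gens Z"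
  by (cases Z) simp

lemma num_gens_halfspace [simp]: "num_gens (cz_halfspace h f Z) = Suc (num_gens Z)"
  by (cases Z) (simp add: Let_def append_zero_cols_def)

lemma num_gens_relu_coord:
  assumes "\<forall>J \<in> set Js. g \<le> num_gens J" "J \<in> set (relu_coord n I i Js)"
  shows "g \<le> num_gens J"
proof -
  from assms(2) obtain Y where "Y \<in> set Js"
    and "J = Y \<or> J = cz_linear (proj_mat n i) Y \<or>
         J = cz_halfspace (- unit_vec n i) 0 Y \<or>
         J = cz_linear (proj_mat n i) (cz_halfspace (unit_vec n i) 0 Y)"
    unfolding relu_coord_def
    by (simp split: if_splits) blast+
  then show ?thesis
    using assms(1) num_gens_affine num_gens_linear num_gens_halfspace le_SucI by metis
qed

lemma num_gens_fold_relu_coord: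
  assumes "\<forall>J \<in> set Js. g \<le> num_gens J"
  shows "\<forall>J \<in> set (fold (relu_coord n I) ks Js). g \<le> num_gens J"
  using assms
proof (induction ks arbitrary: Js)
  case (Cons i ks)
  have "\<forall>J \<in> set (relu_coord n I i Js). g \<le> num_gens J"
    using num_gens_relu_coord[OF Cons.prems] by blast
  from Cons.IH[OF this] show ?case by simp
qed simp

lemma num_gens_relu_layer:
  assumes "J \<in> set (relu_layer W v Z)"
  shows "num_gens Z \<le> num_gens J"
proof -
  have "\<forall>J \<in> set [cz_affine W v Z]. num_gens Z \<le> num_gens J"
    by simp
  from num_gens_fold_relu_coord[OF this] assms show ?thesis
    unfolding relu_layer_def Let_def by blast
qed

lemma num_gens_hidden_pieces:
  "J \<in> set (hidden_pieces W v Z k) \<Longrightarrow> num_gens Z \<le> num_gens J"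
proof (induction k arbitrary: J)
  case (Suc k)
  then obtain Y where "Y \<in> set (hidden_pieces W v Z k)" "J \<in> set (relu_layer (W k) (v k) Y)"
    by auto
  then show ?case using Suc.IH num_gens_relu_layer le_trans by blast
qed simp

lemma num_gens_exact_output:
  "J \<in> set (exact_output L W v Z) \<Longrightarrow> num_gens Z \<le> num_gens J"
  by (auto simp: exact_output_def dest: num_gens_hidden_pieces)

end

theory Submission
  imports "HOL-Analysis.Function_Topology" Defs
begin

text \<open>
  The closed loop needs \<open>x\<close> and \<open>\<pi> x\<close> for the same \<open>x\<close>, so knowing the set \<open>\<pi>(\<Z>)\<close> is not
  enough: adding \<open>A\<^sub>d \<Z>\<close> to \<open>B\<^sub>d \<pi>(\<Z>)\<close> as sets would pair unrelated points. What saves the formula is that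
  the algorithm only ever applies affine maps, appends generators and appends constraints. The
  coefficient vector of an output point therefore still begins with the coefficient vector of an
  input point, and that input point is a preimage under \<open>\<pi>\<close>. Padding \<open>G\<close> with zero columns
  recovers the input point from the longer vector, and both summands of the closed loop become
  affine functions of one and the same coefficient vector.

  This is made precise by the relation \<open>parametrizes f Z Js\<close>: truncating coefficients maps the
  feasible coefficients of each piece into those of \<open>Z\<close>, every feasible coefficient vector of \<open>Z\<close> is
  reached, and the point of a piece is the image under \<open>f\<close> of the point of \<open>Z\<close> with the truncated
  coefficients. The relation composes (\<open>parametrizes_compose\<close>), so it is enough to establish it for
  an affine map and for the ReLU of a single coordinate (\<open>parametrizes_relu_coord_pieces\<close>).

  The delicate case is a split into two halfspaces. The slack generator added for a halfspace
  is sure to model the intersection if its weight \<open>d\<^sub>m\<close> is nonnegative, that is, if the halfspace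
  meets the box image obtained by dropping the constraints; for negative \<open>d\<^sub>m\<close> it can admit points
  outside the halfspace. Splitting happens only at coordinates whose range over the affine image
  contains both signs, and a coordinate that has not been processed yet has the same center entry
  and the same sum of absolute generator entries in every piece as in that image.
  Hence \<open>d\<^sub>m \<ge> 0\<close> at each split of a nonempty piece, and an empty piece stays empty under any
  further constraint. Reading off the two signs requires the minimum and the maximum of the
  coordinate to be attained, which is compactness of the feasible coefficients
  (\<open>coord_extrema_exist\<close>).
\<close>

section \<open>Generator coefficients of a constrained zonotope\<close>

text \<open>The set \<open>cz_set Z\<close> forgets which coefficients produced a point; these two functions keep them, so
  that points of different pieces can be matched by their coefficients.\<close>

fun params :: "cz_data \<Rightarrow> real vec set" where
  "params (c, G, A, b) =
     {\<xi> \<in> carrier_vec (dim_col G). (\<forall>r < dim_col G. \<bar>\<xi> $ r\<bar> \<le> 1) \<and> A *\<^sub>v \<xi> = b}"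

fun point :: "cz_data \<Rightarrow> real vec \<Rightarrow> real vec" where
  "point (c, G, A, b) \<xi> = G *\<^sub>v \<xi> + c"

fun cz_dims :: "nat \<Rightarrow> cz_data \<Rightarrow> bool" where
  "cz_dims n (c, G, A, b) \<longleftrightarrow>
     c \<in> carrier_vec n \<and> dim_row G = n \<and> dim_col A = dim_col G \<and> dim_vec b = dim_row A"

lemma cz_set_eq: "cz_set Z = point Z ` params Z"
  by (cases Z) (auto simp: CZ_def)

lemma params_carrier: "\<xi> \<in> params Z \<Longrightarrow> \<xi> \<in> carrier_vec (num_gens Z)"
  by (cases Z) auto

lemma point_carrier: "cz_dims n Z \<Longrightarrow> point Z \<xi> \<in> carrier_vec n"
  by (cases Z) (auto intro!: carrier_vecI)

lemma vec_first_append: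
  assumes "\<xi> \<in> carrier_vec g"
  shows "vec_first (\<xi> @\<^sub>v \<sigma>) g = \<xi>"
  using assms by (auto simp: vec_first_def)

lemma vec_first_vec_first: "i \<le> j \<Longrightarrow> vec_first (vec_first \<xi> j) i = vec_first \<xi> i"
  by (auto simp: vec_first_def)

lemma vec_first_self: "\<xi> \<in> carrier_vec g \<Longrightarrow> vec_first \<xi> g = \<xi>"
  by (auto simp: vec_first_def)

lemma vec_first_params: "\<xi> \<in> params Z \<Longrightarrow> vec_first \<xi> (num_gens Z) = \<xi>"
  by (rule vec_first_self[OF params_carrier])

lemma append_zero_cols_mult:
  assumes "\<xi> \<in> carrier_vec (dim_col G)" "\<sigma> \<in> carrier_vec k"
  shows "append_zero_cols G k *\<^sub>v (\<xi> @\<^sub>v \<sigma>) = G *\<^sub>v \<xi>"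
proof -
  have G: "G \<in> carrier_mat (dim_row G) (dim_col G)" by simp
  have "append_zero_cols G k *\<^sub>v (\<xi> @\<^sub>v \<sigma>) =
    (G *\<^sub>v \<xi> + 0\<^sub>m (dim_row G) k *\<^sub>v \<sigma>) @\<^sub>v (0\<^sub>m 0 (dim_col G) *\<^sub>v \<xi> + 0\<^sub>m 0 k *\<^sub>v \<sigma>)"
    unfolding append_zero_cols_def
    by (rule four_block_mat_mult_vec[OF G]) (use assms in auto)
  also have "\<dots> = G *\<^sub>v \<xi>"
    using assms by (intro eq_vecI) auto
  finally show ?thesis .
qed

section \<open>Families of pieces that parametrize a map\<close>

text \<open>The first conjunct says that pieces contain nothing but images under \<open>f\<close>, the second that nothing
  is lost. The condition on the numbers of generators makes successive truncations compose.\<close>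

definition parametrizes :: "(real vec \<Rightarrow> real vec) \<Rightarrow> cz_data \<Rightarrow> cz_data list \<Rightarrow> bool" where
  "parametrizes f Z Js \<longleftrightarrow>
     (\<forall>J \<in> set Js. num_gens Z \<le> num_gens J \<and>
        (\<forall>\<eta> \<in> params J. vec_first \<eta> (num_gens Z) \<in> params Z \<and>
           point J \<eta> = f (point Z (vec_first \<eta> (num_gens Z))))) \<and>
     (\<forall>\<xi> \<in> params Z. \<exists>J \<in> set Js. \<exists>\<eta> \<in> params J. vec_first \<eta> (num_gens Z) = \<xi>)"

lemma parametrizes_cong:
  assumes "\<And>p. p \<in> cz_set Z \<Longrightarrow> f p = g p" "parametrizes f Z Js"
  shows "parametrizes g Z Js"
proof -
  have "f (point Z \<xi>) = g (point Z \<xi>)" if "\<xi> \<in> params Z" for \<xi>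
    using assms(1) that by (simp add: cz_set_eq)
  then show ?thesis using assms(2) unfolding parametrizes_def by metis
qed

lemma parametrizes_singleton:
  assumes "num_gens J = num_gens Z" "params J = params Z"
    and "\<And>\<xi>. \<xi> \<in> params Z \<Longrightarrow> point J \<xi> = f (point Z \<xi>)"
  shows "parametrizes f Z [J]"
  using assms vec_first_params[of _ Z] unfolding parametrizes_def by simp

lemma parametrizes_id:
  assumes "\<And>p. p \<in> cz_set Z \<Longrightarrow> f p = p"
  shows "parametrizes f Z [Z]"
  by (rule parametrizes_singleton) (use assms in \<open>auto simp: cz_set_eq\<close>)

text \<open>A piece denotes the empty set exactly when it has no feasible coefficients, and then it contributes
  to neither conjunct.\<close>

lemma parametrizes_filter_nonempty:
  assumes "parametrizes f Z Js"
  shows "parametrizes f Z (filter (\<lambda>J. cz_set J \<noteq> {}) Js)"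
proof -
  have "cz_set J \<noteq> {}" if "\<eta> \<in> params J" for J \<eta>
    using that by (auto simp: cz_set_eq)
  then show ?thesis using assms unfolding parametrizes_def set_filter by blast
qed

lemma parametrizes_compose:
  assumes f: "parametrizes f Z Js"
    and g: "\<And>J. J \<in> set Js \<Longrightarrow> parametrizes g J (Ks J)"
  shows "parametrizes (g \<circ> f) Z (concat (map Ks Js))"
  unfolding parametrizes_def
proof (intro conjI ballI)
  fix K assume "K \<in> set (concat (map Ks Js))"
  then obtain J where J: "J \<in> set Js" "K \<in> set (Ks J)" by auto
  have le: "num_gens Z \<le> num_gens J" "num_gens J \<le> num_gens K"
    using f g[OF J(1)] J unfolding parametrizes_def by auto
  then show "num_gens Z \<le> num_gens K" by simp
  fix \<eta> assume \<eta>: "\<eta> \<in> params K"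
  let ?\<zeta> = "vec_first \<eta> (num_gens J)"
  have "?\<zeta> \<in> params J" "point K \<eta> = g (point J ?\<zeta>)"
    using g[OF J(1)] J(2) \<eta> unfolding parametrizes_def by auto
  moreover from this(1) have "vec_first ?\<zeta> (num_gens Z) \<in> params Z"
    "point J ?\<zeta> = f (point Z (vec_first ?\<zeta> (num_gens Z)))"
    using f J(1) unfolding parametrizes_def by blast+
  ultimately show "vec_first \<eta> (num_gens Z) \<in> params Z"
    "point K \<eta> = (g \<circ> f) (point Z (vec_first \<eta> (num_gens Z)))"
    by (simp_all add: vec_first_vec_first[OF le(1)])
next
  fix \<xi> assume "\<xi> \<in> params Z"
  then obtain J \<zeta> where J: "J \<in> set Js" "\<zeta> \<in> params J" "vec_first \<zeta> (num_gens Z) = \<xi>"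
    using f unfolding parametrizes_def by blast
  then obtain K \<eta> where K: "K \<in> set (Ks J)" "\<eta> \<in> params K" "vec_first \<eta> (num_gens J) = \<zeta>"
    using g[OF J(1)] unfolding parametrizes_def by blast
  have "num_gens Z \<le> num_gens J"
    using f J(1) unfolding parametrizes_def by blast
  from vec_first_vec_first[OF this, of \<eta>] J(3) K(3)
  have "vec_first \<eta> (num_gens Z) = \<xi>" by simp
  then show "\<exists>K \<in> set (concat (map Ks Js)). \<exists>\<eta> \<in> params K. vec_first \<eta> (num_gens Z) = \<xi>"
    using J(1) K by auto
qed

section \<open>Affine images\<close>

lemma params_affine [simp]: "params (cz_affine W v Z) = params Z"
  by (cases Z) simp

lemma params_linear [simp]: "params (cz_linear M Z) = params Z"
  by (cases Z) simp

lemma point_linear: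
  assumes "cz_dims n Z" "M \<in> carrier_mat k n" "\<xi> \<in> params Z"
  shows "point (cz_linear M Z) \<xi> = M *\<^sub>v point Z \<xi>"
proof (cases Z)
  case (fields c G A b)
  have "G *\<^sub>v \<xi> \<in> carrier_vec n" "c \<in> carrier_vec n"
    using assms(1) fields by (auto intro!: carrier_vecI)
  then have "M *\<^sub>v (G *\<^sub>v \<xi> + c) = M *\<^sub>v (G *\<^sub>v \<xi>) + M *\<^sub>v c"
    by (rule mult_add_distrib_mat_vec[OF assms(2)])
  moreover have "(M * G) *\<^sub>v \<xi> = M *\<^sub>v (G *\<^sub>v \<xi>)"
    by (rule assoc_mult_mat_vec[OF assms(2)]) (use assms fields in auto)
  ultimately show ?thesis using fields by simp
qed

lemma point_affine:
  assumes "cz_dims n Z" "W \<in> carrier_mat k n" "v \<in> carrier_vec k" "\<xi> \<in> params Z"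
  shows "point (cz_affine W v Z) \<xi> = W *\<^sub>v point Z \<xi> + v"
proof (cases Z)
  case (fields c G A b)
  have "(W * G) *\<^sub>v \<xi> + (W *\<^sub>v c + v) = (W * G) *\<^sub>v \<xi> + W *\<^sub>v c + v"
    using assms fields by (intro eq_vecI) auto
  then show ?thesis using point_linear[OF assms(1,2,4)] fields by simp
qed

lemma cz_dims_linear: "cz_dims n Z \<Longrightarrow> M \<in> carrier_mat k n \<Longrightarrow> cz_dims k (cz_linear M Z)"
  by (cases Z) auto

lemma cz_dims_affine:
  "cz_dims n Z \<Longrightarrow> W \<in> carrier_mat k n \<Longrightarrow> v \<in> carrier_vec k \<Longrightarrow> cz_dims k (cz_affine W v Z)"
  by (cases Z) auto

lemma parametrizes_linear:
  assumes "cz_dims n Z" "M \<in> carrier_mat k n"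
    and "\<And>p. p \<in> cz_set Z \<Longrightarrow> f p = M *\<^sub>v p"
  shows "parametrizes f Z [cz_linear M Z]"
  by (rule parametrizes_singleton) (use assms in \<open>auto simp: cz_set_eq point_linear\<close>)

lemma parametrizes_affine:
  assumes "cz_dims n Z" "W \<in> carrier_mat k n" "v \<in> carrier_vec k"
  shows "parametrizes (\<lambda>p. W *\<^sub>v p + v) Z [cz_affine W v Z]"
  by (rule parametrizes_singleton) (use assms in \<open>auto simp: point_affine\<close>)

section \<open>Halfspace intersections\<close>

lemma scalar_prod_point:
  fixes h :: "real vec"
  assumes "cz_dims n (c, G, A, b)" "h \<in> carrier_vec n" "\<xi> \<in> carrier_vec (dim_col G)"
  shows "h \<bullet> point (c, G, A, b) \<xi> = (\<Sum>r<dim_col G. (h \<bullet> col G r) * \<xi> $ r) + h \<bullet> c"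
proof -
  have "h \<bullet> (G *\<^sub>v \<xi>) = (mat_of_row h * G *\<^sub>v \<xi>) $ 0"
    using assms by (subst assoc_mult_mat_vec[of _ 1 n _ "dim_col G"]) auto
  also have "\<dots> = (\<Sum>r<dim_col G. (h \<bullet> col G r) * \<xi> $ r)"
    using assms by (auto simp: scalar_prod_def[of "row _ _"] lessThan_atLeast0)
  finally have linear: "h \<bullet> (G *\<^sub>v \<xi>) = (\<Sum>r<dim_col G. (h \<bullet> col G r) * \<xi> $ r)" .
  have "G *\<^sub>v \<xi> \<in> carrier_vec n" "c \<in> carrier_vec n"
    using assms(1) by (auto intro!: carrier_vecI)
  from scalar_prod_add_distrib[OF assms(2) this] show ?thesis
    by (simp add: linear)
qed

text \<open>Coefficients range over a box, so a linear functional deviates from its value at the center by at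
  most the sum of the absolute contributions of the generators.\<close>

lemma scalar_prod_point_bound:
  assumes "cz_dims n (c, G, A, b)" "h \<in> carrier_vec n" "\<xi> \<in> params (c, G, A, b)"
  shows "\<bar>h \<bullet> point (c, G, A, b) \<xi> - h \<bullet> c\<bar> \<le> (\<Sum>r<dim_col G. \<bar>h \<bullet> col G r\<bar>)"
proof -
  have "\<bar>\<Sum>r<dim_col G. (h \<bullet> col G r) * \<xi> $ r\<bar> \<le> (\<Sum>r<dim_col G. \<bar>(h \<bullet> col G r) * \<xi> $ r\<bar>)"
    by (rule sum_abs)
  also have "\<dots> \<le> (\<Sum>r<dim_col G. \<bar>h \<bullet> col G r\<bar>)"
    using assms(3) by (intro sum_mono) (auto simp: abs_mult intro: mult_left_le)
  finally show ?thesis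
    using assms by (simp add: scalar_prod_point[OF assms(1,2)] del: point.simps)
qed

text \<open>The weight \<open>d\<^sub>m\<close>: the signed distance from \<open>f\<close> down to the least value of \<open>h\<close> on the box image.\<close>

fun halfspace_slack :: "real vec \<Rightarrow> real \<Rightarrow> cz_data \<Rightarrow> real" where
  "halfspace_slack h f (c, G, A, b) = f - h \<bullet> c + (\<Sum>r<dim_col G. \<bar>h \<bullet> col G r\<bar>)"

text \<open>The appended row expresses \<open>h\<close> at the point as \<open>f\<close> minus a multiple, between \<open>0\<close> and \<open>1\<close>, of the
  slack; the new coefficient selects the multiple. Whatever the sign of the slack, truncating feasible
  coefficients leaves coefficients that were feasible before.\<close>

lemma params_halfspace_append:
  assumes "cz_dims n J" "h \<in> carrier_vec n"
    and "\<xi> \<in> carrier_vec (num_gens J)" "\<sigma> \<in> carrier_vec 1"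
  shows "\<xi> @\<^sub>v \<sigma> \<in> params (cz_halfspace h f J) \<longleftrightarrow>
    \<xi> \<in> params J \<and> \<bar>\<sigma> $ 0\<bar> \<le> 1 \<and>
    h \<bullet> point J \<xi> = f - halfspace_slack h f J / 2 * (1 + \<sigma> $ 0)"
proof (cases J)
  case (fields c G A b)
  define d where "d = halfspace_slack h f J"
  let ?A = "four_block_mat A (0\<^sub>m (dim_row A) 1) (mat_of_row h * G) (mat 1 1 (\<lambda>_. d / 2))"
  note dims = assms[unfolded fields, simplified]
  have A\<xi>: "A *\<^sub>v \<xi> \<in> carrier_vec (dim_row A)" and b: "b \<in> carrier_vec (dim_row A)"
    using dims by (auto intro!: carrier_vecI)
  have "G *\<^sub>v \<xi> \<in> carrier_vec n" "c \<in> carrier_vec n"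
    using dims by (auto intro!: carrier_vecI)
  then have "h \<bullet> (G *\<^sub>v \<xi>) = h \<bullet> point J \<xi> - h \<bullet> c"
    using scalar_prod_add_distrib[OF assms(2)] fields by simp
  then have row: "(mat_of_row h * G *\<^sub>v \<xi>) $ 0 = h \<bullet> point J \<xi> - h \<bullet> c"
    using dims by (subst assoc_mult_mat_vec[of _ 1 n _ "dim_col G"]) auto
  have slack: "(mat 1 1 (\<lambda>_. d / 2) *\<^sub>v \<sigma>) $ 0 = d / 2 * \<sigma> $ 0"
    using dims by (simp add: scalar_prod_def)
  have "?A *\<^sub>v (\<xi> @\<^sub>v \<sigma>) = (A *\<^sub>v \<xi> + 0\<^sub>m (dim_row A) 1 *\<^sub>v \<sigma>) @\<^sub>v
      (mat_of_row h * G *\<^sub>v \<xi> + mat 1 1 (\<lambda>_. d / 2) *\<^sub>v \<sigma>)"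
    by (rule four_block_mat_mult_vec[of _ "dim_row A" "dim_col G" _ 1 _ 1])
      (use dims in auto)
  also have "A *\<^sub>v \<xi> + 0\<^sub>m (dim_row A) 1 *\<^sub>v \<sigma> = A *\<^sub>v \<xi>"
    using dims by (intro eq_vecI) auto
  also have "mat_of_row h * G *\<^sub>v \<xi> + mat 1 1 (\<lambda>_. d / 2) *\<^sub>v \<sigma> =
      vec 1 (\<lambda>_. (h \<bullet> point J \<xi> - h \<bullet> c) + d / 2 * \<sigma> $ 0)"
    using row slack by (intro eq_vecI) (auto simp del: index_mult_mat_vec)
  finally have prod: "?A *\<^sub>v (\<xi> @\<^sub>v \<sigma>) =
      A *\<^sub>v \<xi> @\<^sub>v vec 1 (\<lambda>_. (h \<bullet> point J \<xi> - h \<bullet> c) + d / 2 * \<sigma> $ 0)" .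
  have "vec 1 (\<lambda>_. (h \<bullet> point J \<xi> - h \<bullet> c) + d / 2 * \<sigma> $ 0) = vec 1 (\<lambda>_. f - h \<bullet> c - d / 2) \<longleftrightarrow>
      h \<bullet> point J \<xi> = f - d / 2 * (1 + \<sigma> $ 0)"
    by (auto simp: vec_eq_iff algebra_simps)
  then have constr: "?A *\<^sub>v (\<xi> @\<^sub>v \<sigma>) = b @\<^sub>v vec 1 (\<lambda>_. f - h \<bullet> c - d / 2) \<longleftrightarrow>
      A *\<^sub>v \<xi> = b \<and> h \<bullet> point J \<xi> = f - d / 2 * (1 + \<sigma> $ 0)"
    by (simp only: prod append_vec_eq[OF A\<xi> b])
  have box: "(\<forall>r < Suc (dim_col G). \<bar>(\<xi> @\<^sub>v \<sigma>) $ r\<bar> \<le> 1) \<longleftrightarrow>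
      (\<forall>r < dim_col G. \<bar>\<xi> $ r\<bar> \<le> 1) \<and> \<bar>\<sigma> $ 0\<bar> \<le> 1"
    using dims by (auto simp: less_Suc_eq all_conj_distrib)
  have car: "\<xi> @\<^sub>v \<sigma> \<in> carrier_vec (Suc (dim_col G))"
    using append_carrier_vec[of \<xi> "dim_col G" \<sigma> 1] dims by simp
  have slack_eq: "f - h \<bullet> c + (\<Sum>r<dim_col G. \<bar>h \<bullet> col G r\<bar>) = d"
    using fields by (simp add: d_def)
  have cols: "dim_col (append_zero_cols G 1) = Suc (dim_col G)"
    by (simp add: append_zero_cols_def)
  have "\<xi> @\<^sub>v \<sigma> \<in> params (cz_halfspace h f J) \<longleftrightarrow>
      \<xi> @\<^sub>v \<sigma> \<in> carrier_vec (Suc (dim_col G)) \<and> (\<forall>r < Suc (dim_col G). \<bar>(\<xi> @\<^sub>v \<sigma>) $ r\<bar> \<le> 1) \<and>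
      ?A *\<^sub>v (\<xi> @\<^sub>v \<sigma>) = b @\<^sub>v vec 1 (\<lambda>_. f - h \<bullet> c - d / 2)"
    by (simp only: fields cz_halfspace.simps params.simps Let_def slack_eq cols mem_Collect_eq)
  moreover have "\<xi> \<in> params J \<longleftrightarrow> (\<forall>r < dim_col G. \<bar>\<xi> $ r\<bar> \<le> 1) \<and> A *\<^sub>v \<xi> = b"
    using dims fields by simp
  ultimately show ?thesis
    unfolding constr box d_def[symmetric] using car by blast
qed

lemma params_halfspaceE:
  assumes "cz_dims n J" "h \<in> carrier_vec n" "\<eta> \<in> params (cz_halfspace h f J)"
  obtains \<xi> \<sigma> where "\<eta> = \<xi> @\<^sub>v \<sigma>" "vec_first \<eta> (num_gens J) = \<xi>" "\<sigma> \<in> carrier_vec 1"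
    "\<xi> \<in> params J" "\<bar>\<sigma> $ 0\<bar> \<le> 1"
    "h \<bullet> point J \<xi> = f - halfspace_slack h f J / 2 * (1 + \<sigma> $ 0)"
proof -
  have "\<eta> \<in> carrier_vec (num_gens J + 1)"
    using params_carrier[OF assms(3)] by simp
  from vec_first_last_append[OF this]
  have \<eta>: "vec_first \<eta> (num_gens J) @\<^sub>v vec_last \<eta> 1 = \<eta>" .
  then show ?thesis
    using that[of "vec_first \<eta> (num_gens J)" "vec_last \<eta> 1"] assms(3)
      params_halfspace_append[OF assms(1,2), of "vec_first \<eta> (num_gens J)" "vec_last \<eta> 1" f]
    by simp
qed

lemma point_halfspace:
  assumes "cz_dims n J" "h \<in> carrier_vec n" "\<eta> \<in> params (cz_halfspace h f J)"
  shows "point (cz_halfspace h f J) \<eta> = point J (vec_first \<eta> (num_gens J))"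
proof -
  obtain \<xi> \<sigma> where \<eta>: "\<eta> = \<xi> @\<^sub>v \<sigma>" "vec_first \<eta> (num_gens J) = \<xi>" "\<sigma> \<in> carrier_vec 1"
    "\<xi> \<in> params J"
    using params_halfspaceE[OF assms] by metis
  then show ?thesis
    by (cases J) (simp add: Let_def append_zero_cols_mult)
qed

lemma params_halfspace_le:
  assumes "cz_dims n J" "h \<in> carrier_vec n" "halfspace_slack h f J \<ge> 0"
    and "\<eta> \<in> params (cz_halfspace h f J)"
  shows "h \<bullet> point J (vec_first \<eta> (num_gens J)) \<le> f"
proof -
  obtain \<xi> \<sigma> where \<eta>: "vec_first \<eta> (num_gens J) = \<xi>" "\<bar>\<sigma> $ 0\<bar> \<le> 1"
    "h \<bullet> point J \<xi> = f - halfspace_slack h f J / 2 * (1 + \<sigma> $ 0)"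
    using params_halfspaceE[OF assms(1,2,4)] by metis
  moreover have "halfspace_slack h f J / 2 * (1 + \<sigma> $ 0) \<ge> 0"
    using assms(3) \<eta>(2) by (intro mult_nonneg_nonneg) auto
  ultimately show ?thesis by simp
qed

text \<open>On the halfspace the value of \<open>h\<close> lies between \<open>f\<close> minus the slack and \<open>f\<close>, hence it is hit
  by some admissible slack coefficient.\<close>

lemma params_halfspace_lift:
  assumes "cz_dims n J" "h \<in> carrier_vec n" "halfspace_slack h f J \<ge> 0"
    and "\<xi> \<in> params J" "h \<bullet> point J \<xi> \<le> f"
  obtains \<eta> where "\<eta> \<in> params (cz_halfspace h f J)" "vec_first \<eta> (num_gens J) = \<xi>"
proof -
  define d where "d = halfspace_slack h f J"
  define p where "p = h \<bullet> point J \<xi>"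
  have bound: "p \<ge> f - d"
  proof (cases J)
    case (fields c G A b)
    then show ?thesis
      using scalar_prod_point_bound[of n c G A b h \<xi>] assms(1,2,4)
      by (simp add: p_def d_def abs_le_iff del: point.simps params.simps cz_dims.simps)
  qed
  \<comment> \<open>Zero slack forces \<open>p = f\<close>, and then any \<open>s\<close> solves the equation.\<close>
  define s where "s = (if d = 0 then 0 else 2 * (f - p) / d - 1)"
  have "d \<ge> 0" "p \<le> f" using assms by (simp_all add: d_def p_def)
  then have "\<bar>s\<bar> \<le> 1" "p = f - d / 2 * (1 + s)"
    using bound by (auto simp: s_def abs_le_iff field_simps)
  then have "\<xi> @\<^sub>v vec 1 (\<lambda>_. s) \<in> params (cz_halfspace h f J)"
    using assms(4)
      params_halfspace_append[OF assms(1,2) params_carrier[OF assms(4)], of "vec 1 (\<lambda>_. s)" f]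
    by (simp add: d_def[symmetric] p_def[symmetric])
  then show ?thesis
    using that vec_first_append[OF params_carrier[OF assms(4)]] by blast
qed

lemma cz_dims_halfspace:
  "cz_dims n J \<Longrightarrow> h \<in> carrier_vec n \<Longrightarrow> cz_dims n (cz_halfspace h f J)"
  by (cases J) (auto simp: Let_def append_zero_cols_def)

section \<open>Coordinate ranges\<close>

fun coord_center :: "cz_data \<Rightarrow> nat \<Rightarrow> real" where
  "coord_center (c, G, A, b) i = c $ i"

fun coord_radius :: "cz_data \<Rightarrow> nat \<Rightarrow> real" where
  "coord_radius (c, G, A, b) i = (\<Sum>r<dim_col G. \<bar>G $$ (i, r)\<bar>)"

text \<open>For a coordinate halfspace the slack depends only on the center and the radius of that coordinate;
  these are the data that have to be preserved until the coordinate is split.\<close>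

lemma halfspace_slack_unit:
  assumes "cz_dims n J" "i < n"
  shows "halfspace_slack (unit_vec n i) 0 J = coord_radius J i - coord_center J i"
    and "halfspace_slack (- unit_vec n i) 0 J = coord_radius J i + coord_center J i"
  using assms by (cases J; auto intro!: sum.cong)+

lemma point_coord_bounds:
  assumes "cz_dims n J" "i < n" "\<xi> \<in> params J"
  shows "\<bar>point J \<xi> $ i - coord_center J i\<bar> \<le> coord_radius J i"
proof (cases J)
  case (fields c G A b)
  have "unit_vec n i \<bullet> point J \<xi> = point J \<xi> $ i"
    using assms(2) point_carrier[OF assms(1)] by simp
  moreover have "(\<Sum>r<dim_col G. \<bar>unit_vec n i \<bullet> col G r\<bar>) = coord_radius J i"
    using assms(1,2) fields by (auto intro!: sum.cong)
  moreover have "unit_vec n i \<bullet> c = coord_center J i"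
    using assms(1,2) fields by simp
  ultimately show ?thesis
    using scalar_prod_point_bound[of n c G A b "unit_vec n i" \<xi>] assms(1,3) fields
    by (simp del: point.simps params.simps coord_radius.simps coord_center.simps)
qed

text \<open>The feasible coefficients form a closed subset of a cube and each coordinate of the point is a
  continuous function of them. Coefficients are modelled as functions on all natural numbers, where
  the cube is compact by Tychonoff's theorem; entries from \<open>g\<close> on affect neither the constraints
  nor the point.\<close>

lemma coord_extrema_exist:
  assumes "cz_dims n Z" "i < n" "cz_set Z \<noteq> {}"
  shows "\<exists>x \<in> cz_set Z. \<forall>y \<in> cz_set Z. x $ i \<le> y $ i"
    and "\<exists>x \<in> cz_set Z. \<forall>y \<in> cz_set Z. y $ i \<le> x $ i"
proof -
  obtain c G A b where Z: "Z = (c, G, A, b)" by (cases Z)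
  define g where "g = dim_col G"
  define K where "K = (\<Pi>\<^sub>E r \<in> UNIV. {-1..1::real}) \<inter>
    (\<Inter>k<dim_row A. {w. (\<Sum>r<g. A $$ (k, r) * w r) = b $ k})"
  define F where "F = (\<lambda>w::nat \<Rightarrow> real. (\<Sum>r<g. G $$ (i, r) * w r) + c $ i)"
  have coord: "continuous_on S (\<lambda>w::nat \<Rightarrow> real. w r)" for S r
    by (rule continuous_on_subset[OF continuous_on_product_coordinates]) simp
  have "compact (\<Pi>\<^sub>E r \<in> (UNIV :: nat set). {-1..1::real})"
    using compactin_PiE[of "\<lambda>_. euclideanreal" "UNIV :: nat set" "\<lambda>_. {-1..1}"]
    by (simp add: euclidean_product_topology)
  then have "compact K"
    unfolding K_def
    by (intro compact_Int_closed closed_INT ballI closed_Collect_eq continuous_intros coord)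
  have F: "continuous_on K F"
    unfolding F_def by (intro continuous_intros coord)
  have vecs: "params Z = vec g ` K"
  proof (intro equalityI subsetI)
    fix \<xi> assume \<xi>: "\<xi> \<in> params Z"
    let ?w = "\<lambda>r. if r < g then \<xi> $ r else 0"
    have "(A *\<^sub>v \<xi>) $ k = b $ k" if "k < dim_row A" for k
      using \<xi> Z by simp
    then have "?w \<in> K"
      using \<xi> assms(1) Z
      by (auto simp: K_def g_def scalar_prod_def lessThan_atLeast0 abs_le_iff)
    moreover have "vec g ?w = \<xi>"
      using \<xi> Z by (auto simp: g_def)
    ultimately show "\<xi> \<in> vec g ` K" by (intro rev_image_eqI) auto
  next
    fix \<xi> assume "\<xi> \<in> vec g ` K"
    then obtain w where w: "w \<in> K" "\<xi> = vec g w" by blast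
    have "A *\<^sub>v vec g w = b"
      using w(1) assms(1) Z
      by (intro eq_vecI) (auto simp: K_def g_def scalar_prod_def lessThan_atLeast0)
    then show "\<xi> \<in> params Z"
      using w Z by (auto simp: K_def g_def PiE_iff abs_le_iff minus_le_iff)
  qed
  have vals: "point Z (vec g w) $ i = F w" for w
    using assms(1,2) Z by (auto simp: F_def g_def scalar_prod_def lessThan_atLeast0)
  have S: "cz_set Z = (\<lambda>w. point Z (vec g w)) ` K"
    by (auto simp: cz_set_eq vecs)
  then have "K \<noteq> {}" using assms(3) by auto
  then show "\<exists>x \<in> cz_set Z. \<forall>y \<in> cz_set Z. x $ i \<le> y $ i"
    "\<exists>x \<in> cz_set Z. \<forall>y \<in> cz_set Z. y $ i \<le> x $ i"
    using continuous_attains_inf[OF \<open>compact K\<close> _ F] continuous_attains_sup[OF \<open>compact K\<close> _ F]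
    by (auto simp: S vals)
qed

lemma coord_min_least:
  assumes "cz_dims n Z" "i < n" "cz_set Z \<noteq> {}"
  shows "coord_min (cz_set Z) i \<in> (\<lambda>x. x $ i) ` cz_set Z"
    and "x \<in> cz_set Z \<Longrightarrow> coord_min (cz_set Z) i \<le> x $ i"
proof -
  obtain p where p: "p \<in> cz_set Z" "\<forall>y \<in> cz_set Z. p $ i \<le> y $ i"
    using coord_extrema_exist(1)[OF assms] by blast
  have "coord_min (cz_set Z) i = p $ i"
    unfolding coord_min_def by (rule Least_equality) (use p in auto)
  then show "coord_min (cz_set Z) i \<in> (\<lambda>x. x $ i) ` cz_set Z"
    "x \<in> cz_set Z \<Longrightarrow> coord_min (cz_set Z) i \<le> x $ i"
    using p by auto
qed

lemma coord_max_greatest: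
  assumes "cz_dims n Z" "i < n" "cz_set Z \<noteq> {}"
  shows "coord_max (cz_set Z) i \<in> (\<lambda>x. x $ i) ` cz_set Z"
    and "x \<in> cz_set Z \<Longrightarrow> x $ i \<le> coord_max (cz_set Z) i"
proof -
  obtain p where p: "p \<in> cz_set Z" "\<forall>y \<in> cz_set Z. y $ i \<le> p $ i"
    using coord_extrema_exist(2)[OF assms] by blast
  have "coord_max (cz_set Z) i = p $ i"
    unfolding coord_max_def by (rule Greatest_equality) (use p in auto)
  then show "coord_max (cz_set Z) i \<in> (\<lambda>x. x $ i) ` cz_set Z"
    "x \<in> cz_set Z \<Longrightarrow> x $ i \<le> coord_max (cz_set Z) i"
    using p by auto
qed

section \<open>One ReLU layer\<close>

text \<open>The ReLU of a layer is applied one coordinate at a time: \<open>relu_below k\<close> is its state after the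
  coordinates below \<open>k\<close>, and \<open>relu_at k\<close> is the next step.\<close>

definition relu_at :: "nat \<Rightarrow> real vec \<Rightarrow> real vec" where
  "relu_at k x = vec (dim_vec x) (\<lambda>i. if i = k then max 0 (x $ i) else x $ i)"

definition relu_below :: "nat \<Rightarrow> real vec \<Rightarrow> real vec" where
  "relu_below k x = vec (dim_vec x) (\<lambda>i. if i < k then max 0 (x $ i) else x $ i)"

lemma relu_below_0: "relu_below 0 x = x"
  by (auto simp: relu_below_def)

lemma relu_below_Suc: "relu_below (Suc k) = relu_at k \<circ> relu_below k"
  by (auto simp: relu_below_def relu_at_def fun_eq_iff)

lemma relu_below_all: "x \<in> carrier_vec n \<Longrightarrow> relu_below n x = relu x"
  by (auto simp: relu_below_def relu_def)

lemma relu_below_index: "k < dim_vec x \<Longrightarrow> relu_below k x $ k = x $ k"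
  by (simp add: relu_below_def)

lemma proj_mat_carrier [simp]: "proj_mat n i \<in> carrier_mat n n"
  by (simp add: proj_mat_def)

lemma proj_mat_index:
  "r < n \<Longrightarrow> s < n \<Longrightarrow> proj_mat n i $$ (r, s) = (if r = s \<and> s \<noteq> i then 1 else 0)"
  by (simp add: proj_mat_def)

lemma proj_mat_mult_vec:
  assumes "x \<in> carrier_vec n" "r < n"
  shows "(proj_mat n i *\<^sub>v x) $ r = (if r = i then 0 else x $ r)"
proof -
  have "(proj_mat n i *\<^sub>v x) $ r = (\<Sum>s<n. proj_mat n i $$ (r, s) * x $ s)"
    using assms carrier_matD[OF proj_mat_carrier, of n i] by (simp add: scalar_prod_def lessThan_atLeast0)
  also have "\<dots> = (\<Sum>s<n. if s = r then if r = i then 0 else x $ r else 0)"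
    using assms by (intro sum.cong) (auto simp: proj_mat_index)
  finally show ?thesis using assms by simp
qed

lemma relu_at_nonneg: "x $ k \<ge> 0 \<Longrightarrow> relu_at k x = x"
  by (auto simp: relu_at_def)

lemma relu_at_nonpos:
  assumes "x \<in> carrier_vec n" "x $ k \<le> 0"
  shows "relu_at k x = proj_mat n k *\<^sub>v x"
  using assms carrier_matD[OF proj_mat_carrier, of n k]
  by (intro eq_vecI) (auto simp: relu_at_def proj_mat_mult_vec simp del: index_mult_mat_vec)

text \<open>On the halfspace of nonnegative \<open>k\<close>-th coordinate ReLU is the identity, on the opposite one it is
  the projection; points with vanishing coordinate lie in both pieces, where the two maps agree. The
  straddling condition makes both slacks nonnegative. It is demanded only of nonempty pieces: if the
  affine image is empty, its extrema are unspecified and the algorithm may split at any coordinate.\<close>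

lemma parametrizes_relu_at_split:
  assumes J: "cz_dims n J" "k < n"
    and straddle: "params J \<noteq> {} \<Longrightarrow> \<bar>coord_center J k\<bar> \<le> coord_radius J k"
  shows "parametrizes (relu_at k) J
    [cz_halfspace (- unit_vec n k) 0 J,
     cz_linear (proj_mat n k) (cz_halfspace (unit_vec n k) 0 J)]"
proof -
  let ?e = "unit_vec n k :: real vec" and ?g = "num_gens J"
  let ?P = "cz_halfspace (- ?e) 0 J" and ?N = "cz_halfspace ?e 0 J"
  have e: "?e \<in> carrier_vec n" "- ?e \<in> carrier_vec n" by auto
  have coord: "?e \<bullet> point J \<xi> = point J \<xi> $ k" "(- ?e) \<bullet> point J \<xi> = - point J \<xi> $ k" for \<xi>
    using J point_carrier[OF J(1), of \<xi>] by simp_all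
  have slack: "halfspace_slack ?e 0 J \<ge> 0" "halfspace_slack (- ?e) 0 J \<ge> 0"
    if "\<xi> \<in> params J" for \<xi>
  proof -
    have "\<bar>coord_center J k\<bar> \<le> coord_radius J k" using straddle that by blast
    then show "halfspace_slack ?e 0 J \<ge> 0" "halfspace_slack (- ?e) 0 J \<ge> 0"
      by (auto simp: halfspace_slack_unit[OF J])
  qed
  have first: "vec_first \<eta> ?g \<in> params J" if "\<eta> \<in> params ?P \<or> \<eta> \<in> params ?N" for \<eta>
    using that params_halfspaceE[OF J(1) e(1), of \<eta> 0] params_halfspaceE[OF J(1) e(2), of \<eta> 0]
    by metis
  have pos: "point ?P \<eta> = relu_at k (point J (vec_first \<eta> ?g))" if "\<eta> \<in> params ?P" for \<eta>
    using params_halfspace_le[OF J(1) e(2) slack(2)[OF first[OF disjI1[OF that]]] that]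
    by (simp add: coord relu_at_nonneg point_halfspace[OF J(1) e(2) that])
  have neg: "point (cz_linear (proj_mat n k) ?N) \<eta> = relu_at k (point J (vec_first \<eta> ?g))"
    if "\<eta> \<in> params ?N" for \<eta>
    using params_halfspace_le[OF J(1) e(1) slack(1)[OF first[OF disjI2[OF that]]] that]
    by (simp add: coord relu_at_nonpos[OF point_carrier[OF J(1)]] point_halfspace[OF J(1) e(1) that]
        point_linear[OF cz_dims_halfspace[OF J(1) e(1)] proj_mat_carrier that])
  have lift: "(\<exists>\<eta> \<in> params ?P. vec_first \<eta> ?g = \<xi>) \<or> (\<exists>\<eta> \<in> params ?N. vec_first \<eta> ?g = \<xi>)"
    if \<xi>: "\<xi> \<in> params J" for \<xi>
  proof (cases "point J \<xi> $ k \<ge> 0")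
    case True
    then show ?thesis
      using params_halfspace_lift[OF J(1) e(2) slack(2)[OF \<xi>] \<xi>] by (metis coord(2) neg_le_0_iff_le)
  next
    case False
    then show ?thesis
      using params_halfspace_lift[OF J(1) e(1) slack(1)[OF \<xi>] \<xi>] by (metis coord(1) linear)
  qed
  show ?thesis
    unfolding parametrizes_def using first pos neg lift by simp
qed

text \<open>Treating one piece at a time turns \<open>relu_coord\<close> into a concatenation, the form in which
  parametrizations compose.\<close>

definition relu_coord_pieces :: "nat \<Rightarrow> real vec set \<Rightarrow> nat \<Rightarrow> cz_data \<Rightarrow> cz_data list" where
  "relu_coord_pieces n S k J =
     (if coord_min S k < 0 then
        if coord_max S k \<le> 0 then [cz_linear (proj_mat n k) J]
        else [cz_halfspace (- unit_vec n k) 0 J,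
              cz_linear (proj_mat n k) (cz_halfspace (unit_vec n k) 0 J)]
      else [J])"

lemma relu_coord_concat:
  "relu_coord n S k Js =
     filter (\<lambda>J. cz_set J \<noteq> {}) (concat (map (relu_coord_pieces n S k) Js))"
  by (simp add: relu_coord_def relu_coord_pieces_def[abs_def] concat_map_singleton)

lemma coord_box_linear_proj:
  assumes "cz_dims n J" "i < n" "i \<noteq> k"
  shows "coord_center (cz_linear (proj_mat n k) J) i = coord_center J i"
    and "coord_radius (cz_linear (proj_mat n k) J) i = coord_radius J i"
proof -
  obtain c G A b where Z: "J = (c, G, A, b)" by (cases J)
  have "(proj_mat n k * G) $$ (i, r) = G $$ (i, r)" if "r < dim_col G" for r
  proof -
    have "(proj_mat n k * G) $$ (i, r) = (proj_mat n k *\<^sub>v col G r) $ i"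
      using that assms Z carrier_matD[OF proj_mat_carrier, of n k] by simp
    also have "\<dots> = col G r $ i"
      using assms Z by (subst proj_mat_mult_vec) (auto intro!: carrier_vecI)
    finally show ?thesis using that assms Z by simp
  qed
  then show "coord_center (cz_linear (proj_mat n k) J) i = coord_center J i"
    "coord_radius (cz_linear (proj_mat n k) J) i = coord_radius J i"
    using assms Z by (simp_all add: proj_mat_mult_vec del: index_mult_mat_vec index_mult_mat(1))
qed

lemma coord_box_halfspace:
  assumes "cz_dims n J" "i < n"
  shows "coord_center (cz_halfspace h f J) i = coord_center J i"
    and "coord_radius (cz_halfspace h f J) i = coord_radius J i"
  using assms by (cases J; simp add: Let_def append_zero_cols_def)+

text \<open>Splitting at \<open>k\<close> appends zero columns and clears row \<open>k\<close>, so it leaves the boxes of all other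
  coordinates as they were.\<close>

lemma relu_coord_pieces_shape:
  assumes J: "cz_dims n J" and K: "K \<in> set (relu_coord_pieces n S k J)"
  shows "cz_dims n K"
    and "i < n \<Longrightarrow> i \<noteq> k \<Longrightarrow> coord_center K i = coord_center J i \<and> coord_radius K i = coord_radius J i"
proof -
  note H = cz_dims_halfspace[OF J]
  have e: "unit_vec n k \<in> carrier_vec n" "- unit_vec n k \<in> carrier_vec n" by auto
  show "cz_dims n K"
    using K J H[OF e(2)] cz_dims_linear[OF J proj_mat_carrier]
      cz_dims_linear[OF H[OF e(1)] proj_mat_carrier]
    by (auto simp: relu_coord_pieces_def split: if_splits)
  show "coord_center K i = coord_center J i \<and> coord_radius K i = coord_radius J i"
    if "i < n" "i \<noteq> k"
    using K that coord_box_linear_proj[OF J that] coord_box_halfspace[OF J that(1)]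
      coord_box_linear_proj[OF H[OF e(1)] that]
    by (auto simp: relu_coord_pieces_def split: if_splits)
qed

text \<open>The algorithm takes the bounds over the whole affine image \<open>I\<close> rather than over \<open>J\<close>. They still
  bound \<open>J\<close>, since its \<open>k\<close>-th coordinates occur in \<open>I\<close>, and a change of sign over \<open>I\<close> carries over to the
  box of \<open>J\<close>, since the boxes agree in coordinate \<open>k\<close>.\<close>

lemma parametrizes_relu_coord_pieces:
  assumes I: "cz_dims n I" and J: "cz_dims n J" and k: "k < n"
    and box: "coord_center J k = coord_center I k" "coord_radius J k = coord_radius I k"
    and coord: "\<And>p. p \<in> cz_set J \<Longrightarrow> p $ k \<in> (\<lambda>x. x $ k) ` cz_set I"
  shows "parametrizes (relu_at k) J (relu_coord_pieces n (cz_set I) k J)"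
proof -
  let ?lb = "coord_min (cz_set I) k" and ?ub = "coord_max (cz_set I) k"
  have car: "p \<in> carrier_vec n" if "p \<in> cz_set J" for p
    using that point_carrier[OF J] by (auto simp: cz_set_eq)
  have ne: "cz_set I \<noteq> {}" if "p \<in> cz_set J" for p
    using coord[OF that] by auto
  have range: "?lb \<le> p $ k" "p $ k \<le> ?ub" if "p \<in> cz_set J" for p
    using coord[OF that] coord_min_least(2)[OF I k ne[OF that]]
      coord_max_greatest(2)[OF I k ne[OF that]] by auto
  consider "?lb \<ge> 0" | "?lb < 0" "?ub \<le> 0" | "?lb < 0" "?ub > 0" by linarith
  then show ?thesis
  proof cases
    case 1
    then have "parametrizes (relu_at k) J [J]"
      using range(1) by (intro parametrizes_id relu_at_nonneg) force
    then show ?thesis using 1 by (simp add: relu_coord_pieces_def)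
  next
    case 2
    then have "parametrizes (relu_at k) J [cz_linear (proj_mat n k) J]"
      using range(2) car by (intro parametrizes_linear[OF J proj_mat_carrier] relu_at_nonpos) force+
    then show ?thesis using 2 by (simp add: relu_coord_pieces_def)
  next
    case 3
    have "\<bar>coord_center J k\<bar> \<le> coord_radius J k" if "params J \<noteq> {}"
    proof -
      have I_ne: "cz_set I \<noteq> {}" using that ne by (auto simp: cz_set_eq)
      obtain \<xi> \<zeta> where "\<xi> \<in> params I" "point I \<xi> $ k < 0" "\<zeta> \<in> params I" "point I \<zeta> $ k > 0"
        using 3 coord_min_least(1)[OF I k I_ne] coord_max_greatest(1)[OF I k I_ne]
        by (auto simp: cz_set_eq)
      then show ?thesis
        using point_coord_bounds[OF I k, of \<xi>] point_coord_bounds[OF I k, of \<zeta>] box by linarith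
    qed
    then show ?thesis
      using parametrizes_relu_at_split[OF J k] 3 by (simp add: relu_coord_pieces_def)
  qed
qed

text \<open>Besides the parametrization, the induction carries the boxes of the coordinates not yet processed,
  which keep the slacks of later splits nonnegative.\<close>

lemma fold_relu_coord_invariant:
  assumes I: "cz_dims n I" and "k \<le> n"
  defines "Js \<equiv> fold (relu_coord n (cz_set I)) [0..<k] [I]"
  shows "parametrizes (relu_below k) I Js \<and>
    (\<forall>J \<in> set Js. cz_dims n J \<and>
      (\<forall>i \<in> {k..<n}. coord_center J i = coord_center I i \<and> coord_radius J i = coord_radius I i))"
  using \<open>k \<le> n\<close> unfolding Js_def
proof (induction k)
  case 0
  then show ?case using I by (simp add: parametrizes_id relu_below_0)
next
  case (Suc k)
  let ?S = "cz_set I"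
  let ?Js = "fold (relu_coord n ?S) [0..<k] [I]"
  have k: "k < n" using Suc.prems by simp
  have par: "parametrizes (relu_below k) I ?Js"
    and shape: "\<And>J. J \<in> set ?Js \<Longrightarrow> cz_dims n J"
    and box: "\<And>J i. J \<in> set ?Js \<Longrightarrow> k \<le> i \<Longrightarrow> i < n \<Longrightarrow>
      coord_center J i = coord_center I i \<and> coord_radius J i = coord_radius I i"
    using Suc by auto
  have coord: "p $ k \<in> (\<lambda>x. x $ k) ` ?S" if J: "J \<in> set ?Js" and p: "p \<in> cz_set J" for J p
  proof -
    obtain \<xi> where "\<xi> \<in> params I" "p = relu_below k (point I \<xi>)"
      using par J p unfolding parametrizes_def cz_set_eq by blast
    then show ?thesis
      using k point_carrier[OF I, of \<xi>] by (auto simp: cz_set_eq relu_below_index)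
  qed
  have "parametrizes (relu_at k) J (relu_coord_pieces n ?S k J)" if "J \<in> set ?Js" for J
    using parametrizes_relu_coord_pieces[OF I shape[OF that] k] box[OF that] coord[OF that] k
    by auto
  from parametrizes_filter_nonempty[OF parametrizes_compose[OF par this]]
  have "parametrizes (relu_below (Suc k)) I (relu_coord n ?S k ?Js)"
    by (simp add: relu_coord_concat relu_below_Suc)
  moreover have "cz_dims n K \<and> (\<forall>i \<in> {Suc k..<n}.
      coord_center K i = coord_center I i \<and> coord_radius K i = coord_radius I i)"
    if K: "K \<in> set (relu_coord n ?S k ?Js)" for K
  proof -
    obtain J where J: "J \<in> set ?Js" "K \<in> set (relu_coord_pieces n ?S k J)"
      using K by (auto simp: relu_coord_concat)
    then show ?thesis
      using relu_coord_pieces_shape[OF shape[OF J(1)] J(2)] box[OF J(1)] by simp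
  qed
  ultimately show ?case by simp
qed

lemma relu_layer_correct:
  assumes "cz_dims n Z" "W \<in> carrier_mat k n" "v \<in> carrier_vec k"
  shows "parametrizes (\<lambda>x. relu (W *\<^sub>v x + v)) Z (relu_layer W v Z)"
    and "\<forall>J \<in> set (relu_layer W v Z). cz_dims k J"
proof -
  let ?I = "cz_affine W v Z"
  have layer: "relu_layer W v Z = fold (relu_coord k (cz_set ?I)) [0..<k] [?I]"
    using assms(2) by (simp add: relu_layer_def Let_def)
  have I: "cz_dims k ?I" by (rule cz_dims_affine[OF assms])
  have fold: "parametrizes (relu_below k) ?I (relu_layer W v Z)"
    "\<forall>J \<in> set (relu_layer W v Z). cz_dims k J"
    using fold_relu_coord_invariant[OF I order_refl] unfolding layer by blast+
  have "parametrizes (relu_below k \<circ> (\<lambda>p. W *\<^sub>v p + v)) Z (relu_layer W v Z)"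
    using parametrizes_compose[OF parametrizes_affine[OF assms], of "relu_below k" "\<lambda>_. relu_layer W v Z"]
      fold(1) by simp
  then show "parametrizes (\<lambda>x. relu (W *\<^sub>v x + v)) Z (relu_layer W v Z)"
    by (rule parametrizes_cong[rotated]) (use assms(3) in \<open>auto intro!: relu_below_all carrier_vecI\<close>)
  show "\<forall>J \<in> set (relu_layer W v Z). cz_dims k J" by (rule fold(2))
qed

section \<open>The whole network\<close>

lemma hidden_pieces_correct:
  assumes "cz_dims (d 0) Z"
    and "\<And>j. j < k \<Longrightarrow> W j \<in> carrier_mat (d (Suc j)) (d j)"
    and "\<And>j. j < k \<Longrightarrow> v j \<in> carrier_vec (d (Suc j))"
  shows "parametrizes (\<lambda>x. hidden_state W v x k) Z (hidden_pieces W v Z k) \<and>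
    (\<forall>J \<in> set (hidden_pieces W v Z k). cz_dims (d k) J)"
  using assms(2,3)
proof (induction k)
  case 0
  then show ?case using assms(1) by (simp add: parametrizes_id)
next
  case (Suc k)
  then have IH: "parametrizes (\<lambda>x. hidden_state W v x k) Z (hidden_pieces W v Z k)"
    "\<And>J. J \<in> set (hidden_pieces W v Z k) \<Longrightarrow> cz_dims (d k) J"
    by simp_all
  note layer = relu_layer_correct[OF IH(2) Suc.prems(1)[OF lessI] Suc.prems(2)[OF lessI]]
  have "parametrizes ((\<lambda>x. relu (W k *\<^sub>v x + v k)) \<circ> (\<lambda>x. hidden_state W v x k)) Z
      (hidden_pieces W v Z (Suc k))"
    using parametrizes_compose[OF IH(1) layer(1)] by simp
  then show ?case using layer(2) by (auto simp: comp_def)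
qed

lemma exact_output_correct:
  assumes "L \<ge> 1" "cz_dims (d 0) Z"
    and W: "\<And>k. k < L \<Longrightarrow> W k \<in> carrier_mat (d (Suc k)) (d k)"
    and v: "\<And>k. k < L \<Longrightarrow> v k \<in> carrier_vec (d (Suc k))"
  shows "parametrizes (network L W v) Z (exact_output L W v Z)"
    and "\<forall>J \<in> set (exact_output L W v Z). cz_dims (d L) J"
proof -
  let ?k = "L - 1"
  have L: "?k < L" "Suc ?k = L" using assms(1) by auto
  have hidden: "parametrizes (\<lambda>x. hidden_state W v x ?k) Z (hidden_pieces W v Z ?k)"
    "\<And>J. J \<in> set (hidden_pieces W v Z ?k) \<Longrightarrow> cz_dims (d ?k) J"
    using hidden_pieces_correct[where d = d and k = ?k and W = W and v = v, OF assms(2)] W v by auto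
  note Wk = W[OF L(1), unfolded L(2)] and vk = v[OF L(1), unfolded L(2)]
  show "parametrizes (network L W v) Z (exact_output L W v Z)"
    using parametrizes_compose[OF hidden(1) parametrizes_affine[OF hidden(2) Wk vk]]
    by (simp add: exact_output_def concat_map_singleton network_def[abs_def] comp_def)
  show "\<forall>J \<in> set (exact_output L W v Z). cz_dims (d L) J"
    using hidden(2) cz_dims_affine[OF _ Wk vk] by (auto simp: exact_output_def)
qed

section \<open>The closed loop\<close>

text \<open>Padding \<open>G\<close> with zero columns has the same effect as truncating the coefficients, so both summands
  can be evaluated at the coefficients of the output piece.\<close>

lemma closed_loop_point:
  fixes A\<^sub>d B\<^sub>d :: "real mat"
  assumes "A\<^sub>d \<in> carrier_mat n n" "B\<^sub>d \<in> carrier_mat n m"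
    and "cz_dims n (c, G, A, b)" "cz_dims m (c', G', A', b')"
    and "dim_col G \<le> dim_col G'" "\<eta> \<in> carrier_vec (dim_col G')"
  shows "(A\<^sub>d * append_zero_cols G (dim_col G' - dim_col G) + B\<^sub>d * G') *\<^sub>v \<eta>
      + (A\<^sub>d *\<^sub>v c + B\<^sub>d *\<^sub>v c') =
    A\<^sub>d *\<^sub>v point (c, G, A, b) (vec_first \<eta> (dim_col G)) + B\<^sub>d *\<^sub>v point (c', G', A', b') \<eta>"
proof -
  let ?g = "dim_col G" and ?g' = "dim_col G'"
  let ?E = "append_zero_cols G (?g' - ?g)" and ?\<xi> = "vec_first \<eta> ?g"
  have c: "c \<in> carrier_vec n" "c' \<in> carrier_vec m" and rows: "dim_row G = n" "dim_row G' = m"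
    using assms(3,4) by auto
  have G': "G' \<in> carrier_mat m ?g'" and E: "?E \<in> carrier_mat n ?g'"
    using rows assms(5) by (auto simp: append_zero_cols_def intro!: carrier_matI)
  have "?\<xi> @\<^sub>v vec_last \<eta> (?g' - ?g) = \<eta>"
    using assms(5,6) by (intro vec_first_last_append) simp
  then have E\<eta>: "?E *\<^sub>v \<eta> = G *\<^sub>v ?\<xi>"
    using append_zero_cols_mult[of ?\<xi> G "vec_last \<eta> (?g' - ?g)"] by simp
  have car: "G *\<^sub>v ?\<xi> \<in> carrier_vec n" "G' *\<^sub>v \<eta> \<in> carrier_vec m"
    using rows by (auto intro!: carrier_vecI)
  have "(A\<^sub>d * ?E + B\<^sub>d * G') *\<^sub>v \<eta> = (A\<^sub>d * ?E) *\<^sub>v \<eta> + (B\<^sub>d * G') *\<^sub>v \<eta>"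
    by (rule add_mult_distrib_mat_vec[OF mult_carrier_mat[OF assms(1) E]
          mult_carrier_mat[OF assms(2) G'] assms(6)])
  also have "\<dots> = A\<^sub>d *\<^sub>v (G *\<^sub>v ?\<xi>) + B\<^sub>d *\<^sub>v (G' *\<^sub>v \<eta>)"
    by (simp add: assoc_mult_mat_vec[OF assms(1) E assms(6)] assoc_mult_mat_vec[OF assms(2) G' assms(6)] E\<eta>)
  finally show ?thesis
    using assms(1,2)
    by (simp add: mult_add_distrib_mat_vec[OF assms(1) car(1) c(1)]
        mult_add_distrib_mat_vec[OF assms(2) car(2) c(2)])
      (intro eq_vecI; simp)
qed

theorem theorem1:
  fixes n m n\<^sub>G n\<^sub>A L :: nat
    and d :: "nat \<Rightarrow> nat"
    and W :: "nat \<Rightarrow> real mat" and v :: "nat \<Rightarrow> real Matrix.vec"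
    and A\<^sub>d B\<^sub>d G A :: "real mat" and c b :: "real Matrix.vec"
    and \<pi> f\<^sub>c\<^sub>l :: "real Matrix.vec \<Rightarrow> real Matrix.vec"
  assumes "A\<^sub>d \<in> carrier_mat n n" and "B\<^sub>d \<in> carrier_mat n m"
    and "L \<ge> 1" and "d 0 = n" and "d L = m"
    and "\<And>k. k < L \<Longrightarrow> W k \<in> carrier_mat (d (Suc k)) (d k)"
    and "\<And>k. k < L \<Longrightarrow> v k \<in> carrier_vec (d (Suc k))"
    and "\<pi> = network L W v"
    and "f\<^sub>c\<^sub>l = (\<lambda>x. A\<^sub>d *\<^sub>v x + B\<^sub>d *\<^sub>v \<pi> x)"
    and "c \<in> carrier_vec n" and "G \<in> carrier_mat n n\<^sub>G"
    and "A \<in> carrier_mat n\<^sub>A n\<^sub>G" and "b \<in> carrier_vec n\<^sub>A"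
  shows "f\<^sub>c\<^sub>l ` CZ c G A b =
    (\<Union>(c\<^sub>i, G\<^sub>i, A\<^sub>i, b\<^sub>i) \<in> set (exact_output L W v (c, G, A, b)).
       CZ (A\<^sub>d *\<^sub>v c + B\<^sub>d *\<^sub>v c\<^sub>i)
          (A\<^sub>d * append_zero_cols G (dim_col G\<^sub>i - n\<^sub>G) + B\<^sub>d * G\<^sub>i)
          A\<^sub>i b\<^sub>i)"
proof -
  let ?Z = "(c, G, A, b)" and ?Js = "exact_output L W v (c, G, A, b)"
  have Z: "cz_dims n ?Z" using assms by auto
  have g: "num_gens ?Z = n\<^sub>G" "dim_col G = n\<^sub>G" using assms by auto
  have par: "parametrizes \<pi> ?Z ?Js" and dims: "\<forall>J \<in> set ?Js. cz_dims m J"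
    using exact_output_correct[of L d ?Z W v] assms Z by auto
  \<comment> \<open>The closed-loop piece keeps the constraints of the output piece, hence its feasible coefficients.\<close>
  define cl :: "cz_data \<Rightarrow> cz_data" where "cl = (\<lambda>(c\<^sub>i, G\<^sub>i, A\<^sub>i, b\<^sub>i).
    (A\<^sub>d *\<^sub>v c + B\<^sub>d *\<^sub>v c\<^sub>i, A\<^sub>d * append_zero_cols G (dim_col G\<^sub>i - n\<^sub>G) + B\<^sub>d * G\<^sub>i, A\<^sub>i, b\<^sub>i))"
  have cl_params: "params (cl J) = params J" for J
    by (cases J) (simp add: cl_def)
  have cl_point: "point (cl J) \<eta> = f\<^sub>c\<^sub>l (point ?Z (vec_first \<eta> n\<^sub>G))"
    "vec_first \<eta> n\<^sub>G \<in> params ?Z"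
    if J: "J \<in> set ?Js" and \<eta>: "\<eta> \<in> params J" for J \<eta>
  proof -
    have J\<eta>: "n\<^sub>G \<le> num_gens J" "vec_first \<eta> n\<^sub>G \<in> params ?Z"
      "point J \<eta> = \<pi> (point ?Z (vec_first \<eta> n\<^sub>G))"
      using par J \<eta> unfolding parametrizes_def g(1) by blast+
    obtain c' G' A' b' where fields: "J = (c', G', A', b')" by (cases J)
    have "point (cl J) \<eta> = A\<^sub>d *\<^sub>v point ?Z (vec_first \<eta> n\<^sub>G) + B\<^sub>d *\<^sub>v point J \<eta>"
      using closed_loop_point[OF assms(1,2) Z, of c' G' A' b' \<eta>]
        bspec[OF dims J] J\<eta>(1) params_carrier[OF \<eta>]
      by (simp add: fields cl_def g(2))
    then show "point (cl J) \<eta> = f\<^sub>c\<^sub>l (point ?Z (vec_first \<eta> n\<^sub>G))"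
      by (simp only: J\<eta>(3) assms(9))
    show "vec_first \<eta> n\<^sub>G \<in> params ?Z" by (rule J\<eta>(2))
  qed
  have lift: "\<exists>J \<in> set ?Js. \<exists>\<eta> \<in> params J. vec_first \<eta> n\<^sub>G = \<xi>" if "\<xi> \<in> params ?Z" for \<xi>
    using par that unfolding parametrizes_def g(1) by blast
  have "f\<^sub>c\<^sub>l ` cz_set ?Z = (\<Union>J \<in> set ?Js. cz_set (cl J))"
  proof (intro equalityI subsetI)
    fix y assume "y \<in> f\<^sub>c\<^sub>l ` cz_set ?Z"
    then obtain \<xi> where \<xi>: "\<xi> \<in> params ?Z" "y = f\<^sub>c\<^sub>l (point ?Z \<xi>)"
      unfolding cz_set_eq by blast
    then obtain J \<eta> where J: "J \<in> set ?Js" "\<eta> \<in> params J" "vec_first \<eta> n\<^sub>G = \<xi>"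
      using lift by blast
    then have "y = point (cl J) \<eta>" "\<eta> \<in> params (cl J)"
      using cl_point(1)[OF J(1,2)] \<xi>(2) cl_params by auto
    then show "y \<in> (\<Union>J \<in> set ?Js. cz_set (cl J))"
      using J(1) unfolding cz_set_eq by blast
  next
    fix y assume "y \<in> (\<Union>J \<in> set ?Js. cz_set (cl J))"
    then obtain J \<eta> where "J \<in> set ?Js" "\<eta> \<in> params J" "y = point (cl J) \<eta>"
      unfolding cz_set_eq cl_params by blast
    then show "y \<in> f\<^sub>c\<^sub>l ` cz_set ?Z"
      using cl_point unfolding cz_set_eq by blast
  qed
  moreover have "cz_set (cl J) = (case J of (c\<^sub>i, G\<^sub>i, A\<^sub>i, b\<^sub>i) \<Rightarrow>
      CZ (A\<^sub>d *\<^sub>v c + B\<^sub>d *\<^sub>v c\<^sub>i)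
         (A\<^sub>d * append_zero_cols G (dim_col G\<^sub>i - n\<^sub>G) + B\<^sub>d * G\<^sub>i) A\<^sub>i b\<^sub>i)" for J
    by (cases J) (simp add: cl_def)
  ultimately show ?thesis by simp
qed

end
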